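(* There exist sequences of functions $U_n:\mathbb{R}\to\mathbb{R}^2$, $\Omega_n:\mathbb{R}\to so(2)$ (antisymmetric matrices) and $\Omega_{1,n}:\mathbb{R}\to M_2(\mathbb{R})$ such that $$(-\Delta)^{1/4}U_n=\Omega_nU_n+\Omega_{1,n}U_n,$$ $\|U_n\|_{L^2([-1,1])}\to1$ as $n\to+\infty$, $$\lim_{R\to+\infty}\lim_{n\to+\infty}\Big(\|\Omega_n\|_{L^2(B(0,1/R)\setminus B(0,R/n))}+\|\Omega_{1,n}\|_{L^{2,1}(B(0,1/R)\setminus B(0,R/n))}\Big)=0,$$ and nevertheless the energy of $U_n$ does not vanish in the neck region: $$\liminf_{R\to+\infty}\liminf_{n\to+\infty}\|U_n\|_{L^2(B(0,1/R)\setminus B(0,R/n))}>0 .$$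
   Context: $B(0,\rho)=(-\rho,\rho)\subset\mathbb{R}$. Here $(-\Delta)^{1/4}U(t)=\int_{\mathbb{R}}\frac{U(t)-U(s)}{|t-s|^{3/2}}ds$ (the normalizing constant is dropped). $L^{2,1}$ is the Lorentz space of measurable $f$ with $\int_0^{+\infty}|\{x:|f(x)|\ge\lambda\}|^{1/2}d\lambda<+\infty$. *)

theory Defs
  imports "HOL-Analysis.Analysis"
begin

definition ennsqrt :: "ennreal \<Rightarrow> ennreal" where
  "ennsqrt x = (if x = top then top else ennreal (sqrt (enn2real x)))"

text \<open>
  Norms take values in \<open>[0, \<infinity>]\<close>; a measurable function belongs to the space iff its norm is finite.
  On \<open>real ^ 2\<close> and \<open>real ^ 2 ^ 2\<close>, \<^const>\<open>norm\<close> is the Euclidean and the Frobenius norm.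
\<close>

definition L2_on :: "real set \<Rightarrow> (real \<Rightarrow> 'a::euclidean_space) \<Rightarrow> ennreal" where
  "L2_on A f = ennsqrt (\<integral>\<^sup>+x\<in>A. ennreal ((norm (f x))\<^sup>2) \<partial>lebesgue)"

definition Lorentz21_on :: "real set \<Rightarrow> (real \<Rightarrow> 'a::euclidean_space) \<Rightarrow> ennreal" where
  "Lorentz21_on A f =
     (\<integral>\<^sup>+r\<in>{0<..}. ennsqrt (emeasure lebesgue {x\<in>A. norm (f x) \<ge> r}) \<partial>lebesgue)"

text \<open>
  Pointwise \<open>(-\<Delta>)\<^bsup>1/4\<^esup> U(t)\<close>. The integrand at \<open>s = t\<close> is 0 by the convention
  \<open>x / 0 = 0\<close>, on a null set. Since the Bochner integral is 0 for a non-integrable integrand,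
  statements about the value have to be paired with the convergence predicate.
\<close>

definition quarter_laplacian :: "(real \<Rightarrow> 'a::euclidean_space) \<Rightarrow> real \<Rightarrow> 'a" where
  "quarter_laplacian U t = (\<integral>s. (U t - U s) /\<^sub>R (\<bar>t - s\<bar> powr (3/2)) \<partial>lebesgue)"

definition quarter_laplacian_converges :: "(real \<Rightarrow> 'a::euclidean_space) \<Rightarrow> real \<Rightarrow> bool" where
  "quarter_laplacian_converges U t \<longleftrightarrow>
     integrable lebesgue (\<lambda>s. (U t - U s) /\<^sub>R (\<bar>t - s\<bar> powr (3/2)))"

definition so2 :: "(real ^ 2 ^ 2) set" where
  "so2 = {A. transpose A = - A}"

definition neck :: "real \<Rightarrow> nat \<Rightarrow> real set" where
  "neck R n = ball 0 (1 / R) - ball 0 (R / real n)"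

end

theory Submission
  imports Defs "HOL-Real_Asymp.Real_Asymp"
begin

text \<open>
  The function \<open>\<bar>t\<bar>\<^sup>-\<^sup>1\<^sup>/\<^sup>2\<close> is, up to a constant, the fundamental solution of
  \<open>(-\<Delta>)\<close> to the power \<open>1/4\<close> on the line, and its square \<open>1 / \<bar>t\<bar>\<close> has the same mass
  on every dyadic annulus. A bubble with this profile at scale \<open>1 / n\<close> therefore spreads its
  energy over the whole neck, while solving the homogeneous equation there.

  To have an everywhere convergent operator, the fundamental solution is smoothed: let \<open>u\<close> be
  its convolution with the tent function supported in \<open>[-1, 1]\<close>. Then \<open>u\<close> is bounded, Lipschitz
  and positive, and its quarter Laplacian is identically 0 on \<open>\<bar>t\<bar> > 1\<close>
  (\<open>quarter_integral_tent_potential_eq_0\<close>). Take \<open>U\<^sub>n(t) = (u(n t) / \<surd>m\<^sub>n, 0)\<close>, where \<open>m\<^sub>n\<close> makes the norm on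
  \<open>[-1, 1]\<close> equal to 1, take \<open>\<Omega>\<^sub>n = 0\<close>, and let \<open>\<Omega>\<^sub>1\<^sub>,\<^sub>n\<close> be the scalar matrix whose factor is the
  quotient of the quarter Laplacian of the first component by that component. This potential
  lives in \<open>\<bar>t\<bar> \<le> 1 / n\<close>, so both potentials vanish on the neck as soon as \<open>R > 1\<close> and \<open>n > 0\<close>, and the
  iterated limit is 0 without any estimate.

  The energy in the neck is controlled by the two-sided bound
  \<open>1 / (1 + \<bar>t\<bar>) \<le> u(t)\<^sup>2 \<le> K / (1 + \<bar>t\<bar>)\<close> (\<open>tent_potential_square_lower\<close>, \<open>tent_potential_upper\<close>):
  the energy of \<open>u(n t)\<close> is at most a constant times \<open>ln (1 + n) / n\<close> on \<open>[-1, 1]\<close>, and at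
  least \<open>(ln n - O(1)) / n\<close> on the neck, the error depending on \<open>R\<close> only.

  The heart of the matter is that \<open>\<integral> (1 - \<bar>s\<bar>\<^sup>-\<^sup>1\<^sup>/\<^sup>2) / \<bar>1 - s\<bar>\<^sup>3\<^sup>/\<^sup>2 ds = 0\<close>. This integral has
  elementary primitives (\<open>has_bochner_integral_jump_kernel_1\<close>). Scaling gives the statement at
  every point other than the pole, and Fubini's theorem transfers it to \<open>u\<close> off the support of the tent.
\<close>

section \<open>The fundamental solution\<close>

text \<open>
  The endpoints may be infinite or singular for \<open>f\<close>; integrability is then a consequence of the
  constant sign of \<open>f\<close>. The factor \<open>\<sigma>\<close> treats both signs at once.
\<close>

lemma has_bochner_integral_FTC:
  fixes f F :: "real \<Rightarrow> real" and a b :: ereal and \<sigma> :: real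
  assumes "a < b"
    and F: "\<And>x. a < ereal x \<Longrightarrow> ereal x < b \<Longrightarrow> (F has_real_derivative f x) (at x)"
    and cont: "\<And>x. a < ereal x \<Longrightarrow> ereal x < b \<Longrightarrow> isCont f x"
    and \<sigma>: "\<sigma> \<noteq> 0"
    and sgn: "\<And>x. a < ereal x \<Longrightarrow> ereal x < b \<Longrightarrow> 0 \<le> \<sigma> * f x"
    and A: "((F \<circ> real_of_ereal) \<longlongrightarrow> A) (at_right a)"
    and B: "((F \<circ> real_of_ereal) \<longlongrightarrow> B) (at_left b)"
  shows "has_bochner_integral lborel (\<lambda>x. indicator (einterval a b) x * f x) (B - A)"
proof -
  have 1: "((\<lambda>x. \<sigma> * F x) has_real_derivative \<sigma> * f x) (at x)"
    if "a < ereal x" "ereal x < b" for x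
    using F[OF that] by (rule DERIV_cmult)
  have 2: "isCont (\<lambda>x. \<sigma> * f x) x" if "a < ereal x" "ereal x < b" for x
    using cont[OF that] by (intro continuous_intros)
  have 3: "(((\<lambda>x. \<sigma> * F x) \<circ> real_of_ereal) \<longlongrightarrow> \<sigma> * A) (at_right a)"
    using tendsto_mult_left[OF A, of \<sigma>] by (simp add: o_def)
  have 4: "(((\<lambda>x. \<sigma> * F x) \<circ> real_of_ereal) \<longlongrightarrow> \<sigma> * B) (at_left b)"
    using tendsto_mult_left[OF B, of \<sigma>] by (simp add: o_def)
  have 5: "AE x in lborel. a < ereal x \<longrightarrow> ereal x < b \<longrightarrow> 0 \<le> \<sigma> * f x"
    using sgn by auto
  have int: "set_integrable lborel (einterval a b) (\<lambda>x. \<sigma> * f x)"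
    and val: "(LBINT x=a..b. \<sigma> * f x) = \<sigma> * B - \<sigma> * A"
    using interval_integral_FTC_nonneg[OF \<open>a < b\<close> 1 2 5 3 4] by auto
  have int': "integrable lborel (\<lambda>x. indicator (einterval a b) x * f x)"
    using integrable_mult_right[OF int[unfolded set_integrable_def], of "1/\<sigma>"] \<sigma>
    by (simp add: field_simps)
  have "\<sigma> * (\<integral>x. indicator (einterval a b) x * f x \<partial>lborel) = \<sigma> * (B - A)"
    using val \<open>a < b\<close> unfolding interval_lebesgue_integral_def set_lebesgue_integral_def
    by (simp add: less_imp_le mult_ac right_diff_distrib flip: integral_mult_right_zero)
  with int' \<sigma> show ?thesis by (simp add: has_bochner_integral_iff)
qed

definition inv_sqrt :: "real \<Rightarrow> real" where
  "inv_sqrt y = 1 / sqrt \<bar>y\<bar>"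

lemma inv_sqrt_measurable [measurable]: "inv_sqrt \<in> borel_measurable borel"
  unfolding inv_sqrt_def by measurable

lemma inv_sqrt_nonneg [simp]: "0 \<le> inv_sqrt y"
  by (simp add: inv_sqrt_def)

lemma powr_three_halves: "0 \<le> z \<Longrightarrow> z powr (3/2) = z * sqrt z" for z :: real
  using powr_add[of z 1 "1/2"] by (simp add: powr_half_sqrt)

text \<open>
  The integrand of the quarter Laplacian of \<open>\<bar>s\<bar>\<^sup>-\<^sup>1\<^sup>/\<^sup>2\<close> at the point \<open>t\<close>.
\<close>

definition jump_kernel :: "real \<Rightarrow> real \<Rightarrow> real" where
  "jump_kernel t s = (inv_sqrt t - inv_sqrt s) / \<bar>t - s\<bar> powr (3/2)"

lemma jump_kernel_measurable [measurable]:
  "(\<lambda>x. jump_kernel (f x) (g x)) \<in> borel_measurable M"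
  if [measurable]: "f \<in> borel_measurable M" "g \<in> borel_measurable M"
  unfolding jump_kernel_def by measurable

text \<open>
  The inversion \<open>s \<mapsto> 1 / s\<close> turns the integral into its negative, which is why it vanishes. Here the
  primitives suggested by the substitution \<open>s = \<plusminus> x\<^sup>2\<close> are used instead, since they also give
  integrability at 0, 1 and infinity. The four pieces, cut at the singularities and
  at the sign changes, contribute \<open>2\<surd>2 - 2\<close>, \<open>2 - 2\<surd>2\<close>, \<open>-2\<close> and \<open>2\<close>.
\<close>

lemma has_bochner_integral_jump_kernel_1:
  "has_bochner_integral lborel (jump_kernel 1) 0"
proof -
  let ?k = "jump_kernel 1"
  let ?F = "\<lambda>s. 2 * (sqrt s - 1) / sqrt (s - 1)"
  let ?G = "\<lambda>s. 2 * (1 - sqrt s) / sqrt (1 - s)"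
  let ?H = "\<lambda>s. 2 * (1 + sqrt (- s)) / sqrt (1 - s)"
  have cont: "isCont ?k s" if "s \<noteq> 0" "s \<noteq> 1" for s
    unfolding jump_kernel_def inv_sqrt_def using that by (intro continuous_intros) auto
  have pos: "0 \<le> 1 * ?k s" if "\<bar>s\<bar> > 1" for s
    unfolding jump_kernel_def inv_sqrt_def mult_1 using that by (intro divide_nonneg_nonneg) auto
  have neg: "0 \<le> - 1 * ?k s" if "\<bar>s\<bar> < 1" "s \<noteq> 0" for s
    unfolding jump_kernel_def inv_sqrt_def mult_minus_left mult_1 minus_divide_left
    using that by (intro divide_nonneg_nonneg) (auto simp: field_simps)
  have F: "(?F has_real_derivative ?k x) (at x)" if "1 < x" for x
  proof -
    define a where "a = sqrt x" define b where "b = sqrt (x - 1)"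
    have ab: "a > 0" "b > 0" "x - 1 = b * b" "a * a = b * b + 1"
      using that by (auto simp: a_def b_def)
    have k: "?k x = (1 - 1 / a) / ((x - 1) * b)"
      using that by (simp add: jump_kernel_def inv_sqrt_def powr_three_halves a_def b_def)
    have "(?F has_real_derivative (2 * (1 / (2 * a)) * b - 2 * (a - 1) * (1 / (2 * b))) / (b * b)) (at x)"
      using that ab(1,2)
      by (auto intro!: derivative_eq_intros simp: inverse_eq_divide simp flip: a_def b_def)
    also have "(2 * (1 / (2 * a)) * b - 2 * (a - 1) * (1 / (2 * b))) / (b * b) = ?k x"
      unfolding k ab(3) using ab(1,2) by (simp add: divide_simps) (use ab(4) in algebra)
    finally show ?thesis .
  qed
  have G: "(?G has_real_derivative ?k x) (at x)" if "0 < x" "x < 1" for x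
  proof -
    define a where "a = sqrt x" define b where "b = sqrt (1 - x)"
    have ab: "a > 0" "b > 0" "1 - x = b * b" "a * a + b * b = 1"
      using that by (auto simp: a_def b_def)
    have k: "?k x = (1 - 1 / a) / ((1 - x) * b)"
      using that by (simp add: jump_kernel_def inv_sqrt_def powr_three_halves a_def b_def)
    have "(?G has_real_derivative (- 2 * (1 / (2 * a)) * b + 2 * (1 - a) * (1 / (2 * b))) / (b * b)) (at x)"
      using that ab(1,2)
      by (auto intro!: derivative_eq_intros simp: inverse_eq_divide simp flip: a_def b_def)
    also have "(- 2 * (1 / (2 * a)) * b + 2 * (1 - a) * (1 / (2 * b))) / (b * b) = ?k x"
      unfolding k ab(3) using ab(1,2) by (simp add: divide_simps) (use ab(4) in algebra)
    finally show ?thesis .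
  qed
  have H: "(?H has_real_derivative ?k x) (at x)" if "x < 0" for x
  proof -
    define a where "a = sqrt (- x)" define b where "b = sqrt (1 - x)"
    have ab: "a > 0" "b > 0" "1 - x = b * b" "b * b = 1 + a * a"
      using that by (auto simp: a_def b_def)
    have k: "?k x = (1 - 1 / a) / ((1 - x) * b)"
      using that by (simp add: jump_kernel_def inv_sqrt_def powr_three_halves a_def b_def)
    have "(?H has_real_derivative (- 2 * (1 / (2 * a)) * b + 2 * (1 + a) * (1 / (2 * b))) / (b * b)) (at x)"
      using that ab(1,2)
      by (auto intro!: derivative_eq_intros simp: inverse_eq_divide simp flip: a_def b_def)
    also have "(- 2 * (1 / (2 * a)) * b + 2 * (1 + a) * (1 / (2 * b))) / (b * b) = ?k x"
      unfolding k ab(3) using ab(1,2) by (simp add: divide_simps) (use ab(4) in algebra)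
    finally show ?thesis .
  qed
  have I1: "has_bochner_integral lborel (\<lambda>x. indicator (einterval (-\<infinity>) (ereal (-1))) x * ?k x) (4 / sqrt 2 - 2)"
  proof (rule has_bochner_integral_FTC[where \<sigma> = 1 and F = ?H])
    show "((?H \<circ> real_of_ereal) \<longlongrightarrow> 2) (at_right (-\<infinity>))"
      unfolding ereal_tendsto_simps by real_asymp
    have "isCont ?H (-1)" by (intro continuous_intros) auto
    then have "(?H \<longlongrightarrow> ?H (-1)) (at_left (-1))"
      unfolding isCont_def filterlim_at_split by blast
    then show "((?H \<circ> real_of_ereal) \<longlongrightarrow> 4 / sqrt 2) (at_left (ereal (-1)))"
      unfolding ereal_tendsto_simps by simp
  qed (use pos cont H in auto)
  have I2: "has_bochner_integral lborel (\<lambda>x. indicator (einterval (ereal (-1)) (ereal 0)) x * ?k x) (2 - 4 / sqrt 2)"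
  proof (rule has_bochner_integral_FTC[where \<sigma> = "-1" and F = ?H])
    have "isCont ?H (-1)" by (intro continuous_intros) auto
    then have "(?H \<longlongrightarrow> ?H (-1)) (at_right (-1))"
      unfolding isCont_def filterlim_at_split by blast
    then show "((?H \<circ> real_of_ereal) \<longlongrightarrow> 4 / sqrt 2) (at_right (ereal (-1)))"
      unfolding ereal_tendsto_simps by simp
    show "((?H \<circ> real_of_ereal) \<longlongrightarrow> 2) (at_left (ereal 0))"
      unfolding ereal_tendsto_simps by real_asymp
  qed (use neg cont H in auto)
  have I3: "has_bochner_integral lborel (\<lambda>x. indicator (einterval (ereal 0) (ereal 1)) x * ?k x) (0 - 2)"
  proof (rule has_bochner_integral_FTC[where \<sigma> = "-1" and F = ?G])
    show "((?G \<circ> real_of_ereal) \<longlongrightarrow> 2) (at_right (ereal 0))"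
      unfolding ereal_tendsto_simps by real_asymp
    show "((?G \<circ> real_of_ereal) \<longlongrightarrow> 0) (at_left (ereal 1))"
      unfolding ereal_tendsto_simps by real_asymp
  qed (use neg cont G in auto)
  have I4: "has_bochner_integral lborel (\<lambda>x. indicator (einterval (ereal 1) \<infinity>) x * ?k x) (2 - 0)"
  proof (rule has_bochner_integral_FTC[where \<sigma> = 1 and F = ?F])
    show "((?F \<circ> real_of_ereal) \<longlongrightarrow> 0) (at_right (ereal 1))"
      unfolding ereal_tendsto_simps by real_asymp
    show "((?F \<circ> real_of_ereal) \<longlongrightarrow> 2) (at_left \<infinity>)"
      unfolding ereal_tendsto_simps by real_asymp
  qed (use pos cont F in auto)
  note sum = has_bochner_integral_add[OF has_bochner_integral_add[OF has_bochner_integral_add[OF I1 I2] I3] I4]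
  have "AE s in lborel. s \<noteq> -1 \<and> s \<noteq> 0 \<and> s \<noteq> (1::real)"
    by (intro AE_conjI AE_lborel_singleton)
  then have "AE s in lborel. indicator (einterval (-\<infinity>) (ereal (-1))) s * ?k s
      + indicator (einterval (ereal (-1)) (ereal 0)) s * ?k s
      + indicator (einterval (ereal 0) (ereal 1)) s * ?k s
      + indicator (einterval (ereal 1) \<infinity>) s * ?k s = ?k s"
    by eventually_elim (auto simp: einterval_def indicator_def)
  from has_bochner_integral_cong_AE[THEN iffD1, OF _ _ this sum] show ?thesis
    by (simp add: has_bochner_integral_iff)
qed

text \<open>
  The kernel is homogeneous of degree \<open>-2\<close>, so everything follows from \<open>t = 1\<close>. The value of the
  absolute integral is what makes Fubini's theorem applicable to superpositions of translates.
\<close>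

lemma has_bochner_integral_jump_kernel:
  assumes "t \<noteq> 0"
  shows "has_bochner_integral lborel (jump_kernel t) 0"
    and "(\<integral>s. \<bar>jump_kernel t s\<bar> \<partial>lborel) = (\<integral>s. \<bar>jump_kernel 1 s\<bar> \<partial>lborel) / \<bar>t\<bar>"
proof -
  have scale: "jump_kernel t (0 + t * s) = jump_kernel 1 s / t\<^sup>2" for s
  proof -
    have "t - t * s = t * (1 - s)" by (simp add: algebra_simps)
    then have "\<bar>t - t * s\<bar> powr (3/2) = \<bar>t\<bar> * sqrt \<bar>t\<bar> * \<bar>1 - s\<bar> powr (3/2)"
      by (simp add: abs_mult powr_mult powr_three_halves)
    moreover have "inv_sqrt t - inv_sqrt (t * s) = (inv_sqrt 1 - inv_sqrt s) / sqrt \<bar>t\<bar>"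
      by (simp add: inv_sqrt_def abs_mult real_sqrt_mult diff_divide_distrib)
    moreover have "t\<^sup>2 = \<bar>t\<bar> * (sqrt \<bar>t\<bar> * sqrt \<bar>t\<bar>)"
      by (simp add: power2_eq_square flip: abs_mult)
    ultimately show ?thesis
      by (simp add: jump_kernel_def mult_ac)
  qed
  have int: "integrable lborel (jump_kernel 1)" "(\<integral>s. jump_kernel 1 s \<partial>lborel) = 0"
    using has_bochner_integral_jump_kernel_1 by (auto simp: has_bochner_integral_iff)
  have "integrable lborel (\<lambda>s. jump_kernel t (0 + t * s))"
    unfolding scale using int(1) by simp
  then have "integrable lborel (jump_kernel t)"
    using assms by (subst (asm) lborel_integrable_real_affine_iff) auto
  moreover have "(\<integral>s. jump_kernel t s \<partial>lborel) = 0"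
    by (subst lborel_integral_real_affine[OF assms, of _ 0]) (simp only: scale, simp add: int(2))
  ultimately show "has_bochner_integral lborel (jump_kernel t) 0"
    by (simp add: has_bochner_integral_iff)
  show "(\<integral>s. \<bar>jump_kernel t s\<bar> \<partial>lborel) = (\<integral>s. \<bar>jump_kernel 1 s\<bar> \<partial>lborel) / \<bar>t\<bar>"
    unfolding lborel_integral_real_affine[OF assms, of "\<lambda>s. \<bar>jump_kernel t s\<bar>" 0] scale
    using assms by (simp add: abs_divide field_simps power2_eq_square flip: power2_abs[of t])
qed

section \<open>The potential of a tent function\<close>

definition tent :: "real \<Rightarrow> real" where
  "tent y = max 0 (1 - \<bar>y\<bar>)"

lemma tent_measurable [measurable]: "tent \<in> borel_measurable borel"
  unfolding tent_def by measurable

lemma tent_nonneg [simp]: "0 \<le> tent y"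
  by (simp add: tent_def)

lemma tent_le_indicator: "tent y \<le> indicator {-1..1} y"
  by (auto simp: tent_def indicator_def)

lemma tent_diff_le: "\<bar>tent x - tent y\<bar> \<le> \<bar>x - y\<bar> * (indicator {-1..1} x + indicator {-1..1} y)"
  by (auto simp: tent_def indicator_def max_def abs_if split: if_splits)

lemma integral_tent: "has_bochner_integral lborel tent 1"
proof -
  have "has_bochner_integral lborel (\<lambda>x. indicator (einterval (ereal (-1)) (ereal 0)) x * tent x) (0 - (-1/2))"
  proof (rule has_bochner_integral_FTC[where \<sigma> = 1 and F = "\<lambda>x. x + x\<^sup>2/2"])
    show "((\<lambda>x. x + x\<^sup>2/2) has_real_derivative tent x) (at x)"
      if "ereal (-1) < ereal x" "ereal x < ereal 0" for x
      using that by (auto intro!: derivative_eq_intros simp: tent_def)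
    show "isCont tent x" for x
      unfolding tent_def by (intro continuous_intros)
    show "(((\<lambda>x. x + x\<^sup>2/2) \<circ> real_of_ereal) \<longlongrightarrow> -1/2) (at_right (ereal (-1)))"
      unfolding ereal_tendsto_simps by real_asymp
    show "(((\<lambda>x. x + x\<^sup>2/2) \<circ> real_of_ereal) \<longlongrightarrow> 0) (at_left (ereal 0))"
      unfolding ereal_tendsto_simps by real_asymp
  qed auto
  moreover have "has_bochner_integral lborel (\<lambda>x. indicator (einterval (ereal 0) (ereal 1)) x * tent x) (1/2 - 0)"
  proof (rule has_bochner_integral_FTC[where \<sigma> = 1 and F = "\<lambda>x. x - x\<^sup>2/2"])
    show "((\<lambda>x. x - x\<^sup>2/2) has_real_derivative tent x) (at x)"
      if "ereal 0 < ereal x" "ereal x < ereal 1" for x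
      using that by (auto intro!: derivative_eq_intros simp: tent_def)
    show "isCont tent x" for x
      unfolding tent_def by (intro continuous_intros)
    show "(((\<lambda>x. x - x\<^sup>2/2) \<circ> real_of_ereal) \<longlongrightarrow> 0) (at_right (ereal 0))"
      unfolding ereal_tendsto_simps by real_asymp
    show "(((\<lambda>x. x - x\<^sup>2/2) \<circ> real_of_ereal) \<longlongrightarrow> 1/2) (at_left (ereal 1))"
      unfolding ereal_tendsto_simps by real_asymp
  qed auto
  ultimately have sum: "has_bochner_integral lborel
      (\<lambda>x. indicator (einterval (ereal (-1)) (ereal 0)) x * tent x
         + indicator (einterval (ereal 0) (ereal 1)) x * tent x) (0 - (-1/2) + (1/2 - 0))"
    by (rule has_bochner_integral_add)
  have "AE x in lborel. x \<noteq> (0::real)"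
    by (rule AE_lborel_singleton)
  then have "AE x in lborel. indicator (einterval (ereal (-1)) (ereal 0)) x * tent x
         + indicator (einterval (ereal 0) (ereal 1)) x * tent x = tent x"
    by eventually_elim (auto simp: einterval_def indicator_def tent_def)
  from has_bochner_integral_cong_AE[THEN iffD1, OF _ _ this sum] show ?thesis
    by (simp add: has_bochner_integral_iff)
qed

lemma integrable_even:
  fixes f :: "real \<Rightarrow> real"
  assumes even: "\<And>y. f (- y) = f y" and [measurable]: "f \<in> borel_measurable borel"
    and right: "integrable lborel (\<lambda>y. indicator {0<..} y * f y)"
  shows "integrable lborel f"
proof -
  have "integrable lborel (\<lambda>y. indicator {0<..} (0 + (-1) * y) * f (0 + (-1) * y))"
    using right by (rule lborel_integrable_real_affine) simp
  then have sum: "integrable lborel (\<lambda>y. indicator {0<..} y * f y + indicator {0<..} (- y) * f y)"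
    using right by (simp add: even)
  have "AE y in lborel. y \<noteq> (0::real)"
    by (rule AE_lborel_singleton)
  then have "AE y in lborel. indicator {0<..} y * f y + indicator {0<..} (- y) * f y = f y"
    by eventually_elim (auto simp: indicator_def)
  then show ?thesis
    by (rule integrable_cong_AE_imp[OF sum, rotated]) simp
qed

text \<open>
  Up to a constant, this dominates the integrand of the quarter Laplacian of any bounded Lipschitz function.
\<close>

definition lipschitz_majorant :: "real \<Rightarrow> real" where
  "lipschitz_majorant y = min 1 \<bar>y\<bar> / \<bar>y\<bar> powr (3/2)"

lemma lipschitz_majorant_nonneg [simp]: "0 \<le> lipschitz_majorant y"
  by (simp add: lipschitz_majorant_def)

lemma lipschitz_majorant_measurable [measurable]: "lipschitz_majorant \<in> borel_measurable borel"
  unfolding lipschitz_majorant_def by measurable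

lemma integrable_lipschitz_majorant: "integrable lborel lipschitz_majorant"
proof (rule integrable_even)
  have near: "integrable lborel (\<lambda>y. indicator (einterval (ereal 0) (ereal 1)) y * lipschitz_majorant y)"
  proof (rule integrable.intros, rule has_bochner_integral_FTC[where \<sigma> = 1 and F = "\<lambda>y. 2 * sqrt y"])
    show "((\<lambda>y. 2 * sqrt y) has_real_derivative lipschitz_majorant x) (at x)"
      if "ereal 0 < ereal x" "ereal x < ereal 1" for x
      using that by (auto intro!: derivative_eq_intros
          simp: lipschitz_majorant_def powr_three_halves field_simps)
    show "isCont lipschitz_majorant x" if "ereal 0 < ereal x" for x
      using that unfolding lipschitz_majorant_def by (intro continuous_intros) auto
    show "(((\<lambda>y. 2 * sqrt y) \<circ> real_of_ereal) \<longlongrightarrow> 0) (at_right (ereal 0))"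
      unfolding ereal_tendsto_simps by real_asymp
    show "(((\<lambda>y. 2 * sqrt y) \<circ> real_of_ereal) \<longlongrightarrow> 2) (at_left (ereal 1))"
      unfolding ereal_tendsto_simps by real_asymp
  qed auto
  have far: "integrable lborel (\<lambda>y. indicator (einterval (ereal 1) \<infinity>) y * lipschitz_majorant y)"
  proof (rule integrable.intros, rule has_bochner_integral_FTC[where \<sigma> = 1 and F = "\<lambda>y. - 2 / sqrt y"])
    show "((\<lambda>y. - 2 / sqrt y) has_real_derivative lipschitz_majorant x) (at x)"
      if "ereal 1 < ereal x" for x
      using that by (auto intro!: derivative_eq_intros
          simp: lipschitz_majorant_def powr_three_halves field_simps)
    show "isCont lipschitz_majorant x" if "ereal 1 < ereal x" for x
      using that unfolding lipschitz_majorant_def by (intro continuous_intros) auto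
    show "(((\<lambda>y. - 2 / sqrt y) \<circ> real_of_ereal) \<longlongrightarrow> - 2) (at_right (ereal 1))"
      unfolding ereal_tendsto_simps by real_asymp
    show "(((\<lambda>y. - 2 / sqrt y) \<circ> real_of_ereal) \<longlongrightarrow> 0) (at_left \<infinity>)"
      unfolding ereal_tendsto_simps by real_asymp
  qed auto
  have "AE y in lborel. y \<noteq> (1::real)"
    by (rule AE_lborel_singleton)
  then have "AE y in lborel. indicator (einterval (ereal 0) (ereal 1)) y * lipschitz_majorant y
      + indicator (einterval (ereal 1) \<infinity>) y * lipschitz_majorant y
      = indicator {0<..} y * lipschitz_majorant y"
    by eventually_elim (auto simp: einterval_def indicator_def)
  then show "integrable lborel (\<lambda>y. indicator {0<..} y * lipschitz_majorant y)"
    by (rule integrable_cong_AE_imp[OF Bochner_Integration.integrable_add[OF near far], rotated]) simp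
qed (simp_all add: lipschitz_majorant_def)

text \<open>
  Up to a shift these are the potentials of the indicator of \<open>[-1, 1]\<close>. Their uniform bound yields both
  the bound and the Lipschitz constant of the potential of the tent, because the increments of the
  tent are dominated by such indicators.
\<close>

lemma integral_inv_sqrt_window_le:
  obtains B :: real where "0 \<le> B"
    and "\<And>z. integrable lborel (\<lambda>y. indicator {-1..1} (z - y) * inv_sqrt y)"
    and "\<And>z. (\<integral>y. indicator {-1..1} (z - y) * inv_sqrt y \<partial>lborel) \<le> B"
proof -
  let ?h = lipschitz_majorant
  have le: "indicator {-1..1} (z - y) * inv_sqrt y \<le> ?h y + indicator {z-1..z+1} y" for z y
  proof (cases "\<bar>y\<bar> \<le> 1")
    case True
    then have "inv_sqrt y = ?h y"
      by (cases "y = 0") (auto simp: inv_sqrt_def lipschitz_majorant_def powr_three_halves)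
    then show ?thesis by (auto simp: indicator_def)
  next
    case False
    then have "inv_sqrt y \<le> 1" by (simp add: inv_sqrt_def)
    then show ?thesis by (auto simp: indicator_def intro: add_increasing)
  qed
  have int: "integrable lborel (\<lambda>y. ?h y + indicator {z-1..z+1} y)" for z
    using integrable_lipschitz_majorant by simp
  have int': "integrable lborel (\<lambda>y. indicator {-1..1} (z - y) * inv_sqrt y)" for z
    by (rule Bochner_Integration.integrable_bound[OF int[of z]])
      (use le[of z] in \<open>auto simp: abs_mult\<close>)
  show ?thesis
  proof (rule that)
    show "integrable lborel (\<lambda>y. indicator {-1..1} (z - y) * inv_sqrt y)" for z
      by (rule int')
    show "(\<integral>y. indicator {-1..1} (z - y) * inv_sqrt y \<partial>lborel) \<le> (\<integral>y. ?h y \<partial>lborel) + 2" for z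
    proof -
      have "(\<integral>y. indicator {-1..1} (z - y) * inv_sqrt y \<partial>lborel) \<le> (\<integral>y. ?h y + indicator {z-1..z+1} y \<partial>lborel)"
        by (intro integral_mono int int' le)
      also have "\<dots> = (\<integral>y. ?h y \<partial>lborel) + 2"
        using integrable_lipschitz_majorant by (subst Bochner_Integration.integral_add) auto
      finally show ?thesis .
    qed
    show "0 \<le> (\<integral>y. ?h y \<partial>lborel) + 2"
      by (intro add_nonneg_nonneg Bochner_Integration.integral_nonneg) auto
  qed
qed

definition tent_potential :: "real \<Rightarrow> real" where
  "tent_potential t = (\<integral>y. tent (t - y) * inv_sqrt y \<partial>lborel)"

lemma integrable_tent_potential: "integrable lborel (\<lambda>y. tent (t - y) * inv_sqrt y)"
proof -
  obtain B :: real where "\<And>z. integrable lborel (\<lambda>y. indicator {-1..1} (z - y) * inv_sqrt y)"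
    using integral_inv_sqrt_window_le by blast
  from this[of t] show ?thesis
    by (rule Bochner_Integration.integrable_bound)
      (auto simp: abs_mult intro!: mult_right_mono tent_le_indicator)
qed

lemma tent_potential_bounded_lipschitz:
  "\<exists>C\<ge>0. (\<forall>t. tent_potential t \<le> C) \<and>
     (\<forall>t s. \<bar>tent_potential t - tent_potential s\<bar> \<le> C * \<bar>t - s\<bar>)"
proof -
  obtain B :: real where "0 \<le> B"
    and int: "\<And>z. integrable lborel (\<lambda>y. indicator {-1..1} (z - y) * inv_sqrt y)"
    and le: "\<And>z. (\<integral>y. indicator {-1..1} (z - y) * inv_sqrt y \<partial>lborel) \<le> B"
    using integral_inv_sqrt_window_le by blast
  have "tent_potential t \<le> 2 * B" for t
  proof -
    have "tent_potential t \<le> (\<integral>y. indicator {-1..1} (t - y) * inv_sqrt y \<partial>lborel)"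
      unfolding tent_potential_def
      by (intro integral_mono integrable_tent_potential int mult_right_mono tent_le_indicator) simp
    also have "\<dots> \<le> 2 * B" using le[of t] \<open>0 \<le> B\<close> by linarith
    finally show ?thesis .
  qed
  moreover have "\<bar>tent_potential t - tent_potential s\<bar> \<le> 2 * B * \<bar>t - s\<bar>" for t s
  proof -
    have int2: "integrable lborel (\<lambda>y. \<bar>t - s\<bar> * (indicator {-1..1} (t - y) * inv_sqrt y
          + indicator {-1..1} (s - y) * inv_sqrt y))"
      by (intro integrable_mult_right Bochner_Integration.integrable_add int)
    have pt: "\<bar>tent (t - y) * inv_sqrt y - tent (s - y) * inv_sqrt y\<bar>
        \<le> \<bar>t - s\<bar> * (indicator {-1..1} (t - y) * inv_sqrt y + indicator {-1..1} (s - y) * inv_sqrt y)" for y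
    proof -
      have "\<bar>tent (t - y) * inv_sqrt y - tent (s - y) * inv_sqrt y\<bar> = \<bar>tent (t - y) - tent (s - y)\<bar> * inv_sqrt y"
        by (simp add: abs_mult flip: left_diff_distrib)
      also have "\<dots> \<le> (\<bar>t - s\<bar> * (indicator {-1..1} (t - y) + indicator {-1..1} (s - y))) * inv_sqrt y"
        using tent_diff_le[of "t - y" "s - y"] by (intro mult_right_mono) auto
      finally show ?thesis by (simp add: algebra_simps)
    qed
    have "\<bar>tent_potential t - tent_potential s\<bar>
        = \<bar>\<integral>y. tent (t - y) * inv_sqrt y - tent (s - y) * inv_sqrt y \<partial>lborel\<bar>"
      unfolding tent_potential_def
      by (simp add: Bochner_Integration.integral_diff integrable_tent_potential)
    also have "\<dots> \<le> (\<integral>y. \<bar>t - s\<bar> * (indicator {-1..1} (t - y) * inv_sqrt y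
          + indicator {-1..1} (s - y) * inv_sqrt y) \<partial>lborel)"
      by (intro order_trans[OF integral_abs_bound] integral_mono int2 pt integrable_abs
          Bochner_Integration.integrable_diff integrable_tent_potential)
    also have "\<dots> = \<bar>t - s\<bar> * ((\<integral>y. indicator {-1..1} (t - y) * inv_sqrt y \<partial>lborel)
          + (\<integral>y. indicator {-1..1} (s - y) * inv_sqrt y \<partial>lborel))"
      by (simp add: Bochner_Integration.integral_add int)
    also have "\<dots> \<le> \<bar>t - s\<bar> * (B + B)"
      by (intro mult_left_mono add_mono le) simp
    finally show ?thesis by (simp add: mult_ac)
  qed
  ultimately show ?thesis using \<open>0 \<le> B\<close> by (intro exI[of _ "2 * B"]) simp
qed

lemma isCont_tent_potential: "isCont tent_potential t"
proof -
  obtain C where C: "0 \<le> C" "\<And>t. tent_potential t \<le> C"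
    "\<And>t s. \<bar>tent_potential t - tent_potential s\<bar> \<le> C * \<bar>t - s\<bar>"
    using tent_potential_bounded_lipschitz by auto
  then have "C-lipschitz_on UNIV tent_potential"
    by (intro lipschitz_onI) (auto simp: dist_real_def)
  from lipschitz_on_continuous_on[OF this] show ?thesis
    by (simp add: continuous_on_eq_continuous_at)
qed

lemma tent_potential_measurable [measurable]: "tent_potential \<in> borel_measurable borel"
  by (intro borel_measurable_continuous_onI) (simp add: continuous_on_eq_continuous_at isCont_tent_potential)

text \<open>
  The definition convolves with the weight on the tent, which suits increments in \<open>t\<close>. This form
  exhibits the same function as a superposition of translated fundamental solutions.
\<close>

lemma tent_potential_reflected:
  "has_bochner_integral lborel (\<lambda>y. tent y * inv_sqrt (t - y)) (tent_potential t)"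
proof -
  have "integrable lborel (\<lambda>y. tent (t - (t + (-1) * y)) * inv_sqrt (t + (-1) * y))"
    by (rule lborel_integrable_real_affine[OF integrable_tent_potential]) simp
  moreover have "tent_potential t = \<bar>-1\<bar> *\<^sub>R (\<integral>y. tent (t - (t + (-1) * y)) * inv_sqrt (t + (-1) * y) \<partial>lborel)"
    unfolding tent_potential_def by (rule lborel_integral_real_affine) simp
  ultimately show ?thesis by (simp add: has_bochner_integral_iff)
qed

text \<open>
  The tent has mass 1, and all its points are at distance at most \<open>1 + \<bar>t\<bar>\<close> from \<open>t\<close>.
\<close>

lemma tent_potential_lower: "1 / sqrt (1 + \<bar>t\<bar>) \<le> tent_potential t"
proof -
  have "AE y in lborel. y \<noteq> t"
    by (rule AE_lborel_singleton)
  then have ae: "AE y in lborel. 1 / sqrt (1 + \<bar>t\<bar>) * tent y \<le> tent y * inv_sqrt (t - y)"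
  proof eventually_elim
    case (elim y)
    show ?case
    proof (cases "\<bar>y\<bar> \<le> 1")
      case True
      have "1 / sqrt (1 + \<bar>t\<bar>) \<le> inv_sqrt (t - y)"
        unfolding inv_sqrt_def using True elim by (intro divide_left_mono) auto
      then show ?thesis by (subst mult.commute) (intro mult_left_mono, auto)
    qed (simp add: tent_def)
  qed
  have "(\<integral>y. 1 / sqrt (1 + \<bar>t\<bar>) * tent y \<partial>lborel) \<le> (\<integral>y. tent y * inv_sqrt (t - y) \<partial>lborel)"
    by (rule integral_mono_AE[OF _ _ ae])
      (use integral_tent tent_potential_reflected[of t] in \<open>auto simp: has_bochner_integral_iff\<close>)
  then show ?thesis
    using integral_tent tent_potential_reflected[of t] by (auto simp: has_bochner_integral_iff)
qed

lemma tent_potential_pos: "0 < tent_potential t"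
  by (rule less_le_trans[OF _ tent_potential_lower]) (simp add: add_pos_nonneg)

text \<open>
  On the support of the tent, \<open>1 + \<bar>t\<bar> \<le> \<bar>t - y\<bar> + 2\<close>. Multiplying the potential by
  \<open>\<surd>(1 + \<bar>t\<bar>)\<close> hence costs at most the mass of the tent plus \<open>\<surd>2\<close> times the potential itself, which
  is bounded. This handles the core and the tail together.
\<close>

lemma tent_potential_upper:
  obtains K where "0 < K" "\<And>t. (tent_potential t)\<^sup>2 \<le> K / (1 + \<bar>t\<bar>)"
proof -
  obtain C where C: "0 \<le> C" "\<And>t. tent_potential t \<le> C"
    "\<And>t s. \<bar>tent_potential t - tent_potential s\<bar> \<le> C * \<bar>t - s\<bar>"
    using tent_potential_bounded_lipschitz by auto
  have bound: "sqrt (1 + \<bar>t\<bar>) * tent_potential t \<le> 1 + sqrt 2 * C" for t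
  proof -
    have pt: "sqrt (1 + \<bar>t\<bar>) * (tent y * inv_sqrt (t - y)) \<le> tent y + sqrt 2 * (tent y * inv_sqrt (t - y))" for y
    proof (cases "\<bar>y\<bar> \<le> 1 \<and> y \<noteq> t")
      case True
      have "sqrt (1 + \<bar>t\<bar>) \<le> sqrt (\<bar>t - y\<bar> + 2)"
        using True by (intro real_sqrt_le_mono) auto
      also have "\<dots> \<le> sqrt \<bar>t - y\<bar> + sqrt 2"
        by (rule sqrt_add_le_add_sqrt) auto
      finally have "sqrt (1 + \<bar>t\<bar>) * inv_sqrt (t - y) \<le> (sqrt \<bar>t - y\<bar> + sqrt 2) * inv_sqrt (t - y)"
        by (rule mult_right_mono) simp
      also have "\<dots> = 1 + sqrt 2 * inv_sqrt (t - y)"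
        using True by (simp add: inv_sqrt_def field_simps)
      finally have "tent y * (sqrt (1 + \<bar>t\<bar>) * inv_sqrt (t - y)) \<le> tent y * (1 + sqrt 2 * inv_sqrt (t - y))"
        by (rule mult_left_mono) simp
      then show ?thesis by (simp add: algebra_simps)
    next
      case False
      then show ?thesis by (auto simp: tent_def inv_sqrt_def)
    qed
    have "(\<integral>y. sqrt (1 + \<bar>t\<bar>) * (tent y * inv_sqrt (t - y)) \<partial>lborel)
        \<le> (\<integral>y. tent y + sqrt 2 * (tent y * inv_sqrt (t - y)) \<partial>lborel)"
      by (rule integral_mono[OF _ _ pt])
        (use integral_tent tent_potential_reflected[of t] in \<open>auto simp: has_bochner_integral_iff\<close>)
    also have "\<dots> = 1 + sqrt 2 * tent_potential t"
      using integral_tent tent_potential_reflected[of t] by (simp add: has_bochner_integral_iff)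
    also have "\<dots> \<le> 1 + sqrt 2 * C" using C(2) by simp
    finally show ?thesis
      using tent_potential_reflected[of t] by (simp add: has_bochner_integral_iff)
  qed
  show ?thesis
  proof (rule that)
    have "0 < 1 + sqrt 2 * C" using C(1) by (simp add: add_pos_nonneg)
    then show "0 < (1 + sqrt 2 * C)\<^sup>2" by simp
    show "(tent_potential t)\<^sup>2 \<le> (1 + sqrt 2 * C)\<^sup>2 / (1 + \<bar>t\<bar>)" for t
    proof -
      have "(sqrt (1 + \<bar>t\<bar>) * tent_potential t)\<^sup>2 \<le> (1 + sqrt 2 * C)\<^sup>2"
        using bound[of t] tent_potential_pos[of t] by (intro power_mono) auto
      then show ?thesis by (simp add: power_mult_distrib pos_le_divide_eq add_pos_nonneg mult.commute)
    qed
  qed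
qed

section \<open>The quarter Laplacian of the potential\<close>

lemma integrable_quarter_integrand:
  fixes u :: "real \<Rightarrow> real"
  assumes [measurable]: "u \<in> borel_measurable borel"
    and bdd: "\<And>t. \<bar>u t\<bar> \<le> C" and lip: "\<And>t s. \<bar>u t - u s\<bar> \<le> C * \<bar>t - s\<bar>"
  shows "integrable lborel (\<lambda>s. (u t - u s) / \<bar>t - s\<bar> powr (3/2))"
proof -
  have "integrable lborel (\<lambda>s. 2 * C * lipschitz_majorant (t + (-1) * s))"
    by (intro integrable_mult_right lborel_integrable_real_affine integrable_lipschitz_majorant) simp
  then show ?thesis
  proof (rule Bochner_Integration.integrable_bound[OF _ _ AE_I2])
    show "(\<lambda>s. (u t - u s) / \<bar>t - s\<bar> powr (3/2)) \<in> borel_measurable lborel" by measurable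
    fix s
    have "0 \<le> C" using bdd[of t] by linarith
    have "\<bar>u t - u s\<bar> \<le> 2 * C * min 1 \<bar>t - s\<bar>"
    proof (cases "\<bar>t - s\<bar> \<le> 1")
      case True
      have "\<bar>u t - u s\<bar> \<le> C * \<bar>t - s\<bar>" by (rule lip)
      also have "\<dots> \<le> 2 * C * \<bar>t - s\<bar>" using \<open>0 \<le> C\<close> by (intro mult_right_mono) auto
      finally show ?thesis using True by (simp add: min_def)
    next
      case False
      then show ?thesis using bdd[of t] bdd[of s] by (simp add: min_def)
    qed
    then have "\<bar>u t - u s\<bar> / \<bar>t - s\<bar> powr (3/2) \<le> 2 * C * min 1 \<bar>t - s\<bar> / \<bar>t - s\<bar> powr (3/2)"
      by (rule divide_right_mono) simp
    also have "\<dots> = 2 * C * lipschitz_majorant (t + (-1) * s)"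
      by (simp add: lipschitz_majorant_def)
    also have "\<dots> \<le> norm (2 * C * lipschitz_majorant (t + (-1) * s))"
      by (metis abs_ge_self real_norm_def)
    finally show "norm ((u t - u s) / \<bar>t - s\<bar> powr (3/2)) \<le> norm (2 * C * lipschitz_majorant (t + (-1) * s))"
      by (simp add: abs_divide)
  qed
qed

text \<open>
  For \<open>\<bar>t\<bar> > 1\<close> no point \<open>y\<close> of the support of the tent is close to \<open>t\<close>. The absolute integrals
  of the translated kernels are proportional to \<open>1 / \<bar>t - y\<bar>\<close>, hence integrable against the
  tent, and the order of integration may be exchanged; the inner integrals all vanish.
\<close>

lemma quarter_integral_tent_potential_eq_0:
  assumes t: "1 < \<bar>t\<bar>"
  shows "(\<integral>s. (tent_potential t - tent_potential s) / \<bar>t - s\<bar> powr (3/2) \<partial>lborel) = 0"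
proof -
  let ?f = "\<lambda>y s. tent y * jump_kernel (t - y) (s - y)"
  let ?J = "\<integral>s. \<bar>jump_kernel 1 s\<bar> \<partial>lborel"
  have shift: "has_bochner_integral lborel (\<lambda>s. jump_kernel (t - y) (s - y)) 0"
    "(\<integral>s. \<bar>jump_kernel (t - y) (s - y)\<bar> \<partial>lborel) = ?J / \<bar>t - y\<bar>" if "y \<noteq> t" for y
  proof -
    from that have "t - y \<noteq> 0" by simp
    note k = has_bochner_integral_jump_kernel[OF this]
    have "integrable lborel (\<lambda>s. jump_kernel (t - y) (- y + 1 * s))"
      using k(1) by (intro lborel_integrable_real_affine) (auto simp: has_bochner_integral_iff)
    moreover have "(\<integral>s. jump_kernel (t - y) (- y + 1 * s) \<partial>lborel) = 0"
      using k(1) lborel_integral_real_affine[of 1 "jump_kernel (t - y)" "- y"]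
      by (simp add: has_bochner_integral_iff)
    ultimately show "has_bochner_integral lborel (\<lambda>s. jump_kernel (t - y) (s - y)) 0"
      by (simp add: has_bochner_integral_iff)
    show "(\<integral>s. \<bar>jump_kernel (t - y) (s - y)\<bar> \<partial>lborel) = ?J / \<bar>t - y\<bar>"
      using k(2) lborel_integral_real_affine[of 1 "\<lambda>s. \<bar>jump_kernel (t - y) s\<bar>" "- y"] by simp
  qed
  \<comment> \<open>For \<open>y = t\<close> the kernel has its pole at the evaluation point, but there the tent vanishes.\<close>
  have zero: "has_bochner_integral lborel (?f y) 0" for y
  proof (cases "y = t")
    case True
    then have "?f y = (\<lambda>s. 0)" using t by (auto simp: tent_def)
    then show ?thesis by (simp add: has_bochner_integral_zero)
  next
    case False
    from has_bochner_integral_mult_right[OF shift(1)[OF False], of "tent y"] show ?thesis by simp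
  qed
  have norm: "(\<integral>s. norm (?f y s) \<partial>lborel) = tent y * (?J / \<bar>t - y\<bar>)" for y
    using shift(2)[of y] t by (cases "y = t") (auto simp: abs_mult tent_def)
  have "integrable lborel (\<lambda>y. tent y * (?J / \<bar>t - y\<bar>))"
  proof (rule Bochner_Integration.integrable_bound)
    show "integrable lborel (\<lambda>y. tent y * (?J / (\<bar>t\<bar> - 1)))"
      using integral_tent by (auto simp: has_bochner_integral_iff)
    have "norm (tent y * (?J / \<bar>t - y\<bar>)) \<le> norm (tent y * (?J / (\<bar>t\<bar> - 1)))" for y
    proof (cases "\<bar>y\<bar> \<le> 1")
      case True
      have "\<bar>?J / \<bar>t - y\<bar>\<bar> \<le> \<bar>?J / (\<bar>t\<bar> - 1)\<bar>"
        using True t unfolding abs_divide abs_abs by (intro divide_left_mono) auto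
      then show ?thesis
        unfolding real_norm_def abs_mult[of "tent y"] by (rule mult_left_mono) simp
    qed (simp add: tent_def)
    then show "AE y in lborel. norm (tent y * (?J / \<bar>t - y\<bar>)) \<le> norm (tent y * (?J / (\<bar>t\<bar> - 1)))"
      by simp
  qed simp
  then have prod: "integrable (lborel \<Otimes>\<^sub>M lborel) (case_prod ?f)"
    using zero by (intro lborel_pair.Fubini_integrable)
      (simp_all only: prod.case norm, simp_all add: has_bochner_integral_iff)
  have inner: "(\<integral>y. ?f y s \<partial>lborel) = (tent_potential t - tent_potential s) / \<bar>t - s\<bar> powr (3/2)" for s
  proof -
    have "has_bochner_integral lborel
        (\<lambda>y. (tent y * inv_sqrt (t - y) - tent y * inv_sqrt (s - y)) / \<bar>t - s\<bar> powr (3/2))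
        ((tent_potential t - tent_potential s) / \<bar>t - s\<bar> powr (3/2))"
      by (intro has_bochner_integral_divide has_bochner_integral_diff tent_potential_reflected)
    moreover have "(tent y * inv_sqrt (t - y) - tent y * inv_sqrt (s - y)) / \<bar>t - s\<bar> powr (3/2) = ?f y s" for y
      by (simp add: jump_kernel_def right_diff_distrib)
    ultimately show ?thesis by (simp add: has_bochner_integral_iff)
  qed
  have "(\<integral>s. (\<integral>y. ?f y s \<partial>lborel) \<partial>lborel) = (\<integral>y. (\<integral>s. ?f y s \<partial>lborel) \<partial>lborel)"
    by (rule lborel_pair.Fubini_integral[OF prod])
  also have "\<dots> = 0" by (simp only: zero[THEN has_bochner_integral_integral_eq] integral_zero)
  finally show ?thesis by (simp add: inner)
qed

text \<open>
  Reduces the operator on functions with a fixed direction \<open>e\<close> to a real Lebesgue integral with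
  respect to Borel measure, where Fubini's theorem and affine substitution are available.
\<close>

lemma quarter_laplacian_scaleR:
  fixes v :: "real \<Rightarrow> real" and e :: "'a::euclidean_space"
  assumes [measurable]: "v \<in> borel_measurable borel"
    and int: "integrable lborel (\<lambda>s. (v t - v s) / \<bar>t - s\<bar> powr (3/2))"
  shows "quarter_laplacian_converges (\<lambda>t. v t *\<^sub>R e) t"
    and "quarter_laplacian (\<lambda>t. v t *\<^sub>R e) t
      = (\<integral>s. (v t - v s) / \<bar>t - s\<bar> powr (3/2) \<partial>lborel) *\<^sub>R e"
proof -
  have eq: "(v t *\<^sub>R e - v s *\<^sub>R e) /\<^sub>R (\<bar>t - s\<bar> powr (3/2))
      = ((v t - v s) / \<bar>t - s\<bar> powr (3/2)) *\<^sub>R e" for s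
    by (simp only: scaleR_diff_left[symmetric] scaleR_scaleR divide_inverse mult.commute)
  have [measurable]: "(\<lambda>s. ((v t - v s) / \<bar>t - s\<bar> powr (3/2)) *\<^sub>R e) \<in> borel_measurable lborel"
    by measurable
  show "quarter_laplacian_converges (\<lambda>t. v t *\<^sub>R e) t"
    unfolding quarter_laplacian_converges_def eq using int
    by (subst integrable_completion) auto
  show "quarter_laplacian (\<lambda>t. v t *\<^sub>R e) t
      = (\<integral>s. (v t - v s) / \<bar>t - s\<bar> powr (3/2) \<partial>lborel) *\<^sub>R e"
    unfolding quarter_laplacian_def eq using int
    by (subst integral_completion) auto
qed

lemma quarter_integral_tent_potential_rescaled_eq_0:
  assumes "1 < \<bar>c * t\<bar>"
  shows "(\<integral>s. (tent_potential (c * t) - tent_potential (c * s)) / \<bar>t - s\<bar> powr (3/2) \<partial>lborel) = 0"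
proof -
  have c: "c \<noteq> 0" using assms by auto
  let ?f = "\<lambda>s. (tent_potential (c * t) - tent_potential s) / \<bar>c * t - s\<bar> powr (3/2)"
  have "(tent_potential (c * t) - tent_potential (c * s)) / \<bar>t - s\<bar> powr (3/2)
      = \<bar>c\<bar> powr (3/2) * ?f (0 + c * s)" for s
    using c by (simp add: powr_mult abs_mult flip: right_diff_distrib)
  moreover have "(\<integral>s. ?f (0 + c * s) \<partial>lborel) = 0"
    using lborel_integral_real_affine[OF c, of ?f 0] quarter_integral_tent_potential_eq_0[OF assms] c by simp
  ultimately show ?thesis by (simp only: integral_mult_right_zero mult_zero_right)
qed

section \<open>Norms and energies\<close>

lemma ennsqrt_mono: "x \<le> y \<Longrightarrow> ennsqrt x \<le> ennsqrt y"
  by (auto simp: ennsqrt_def top_unique enn2real_mono less_top intro!: ennreal_leI)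

lemma ennsqrt_ennreal: "0 \<le> x \<Longrightarrow> ennsqrt (ennreal x) = ennreal (sqrt x)"
  by (simp add: ennsqrt_def)

lemma L2_on_scaleR:
  "norm e = 1 \<Longrightarrow> L2_on A (\<lambda>t. v t *\<^sub>R e) = ennsqrt (\<integral>\<^sup>+t. ennreal ((v t)\<^sup>2) * indicator A t \<partial>lborel)"
  by (simp add: L2_on_def nn_integral_completion)

lemma L2_on_zero: "(\<And>t. t \<in> A \<Longrightarrow> f t = 0) \<Longrightarrow> L2_on A f = 0"
  unfolding L2_on_def
  by (subst nn_integral_cong[where v = "\<lambda>_. 0"]) (auto simp: indicator_def ennsqrt_def)

lemma Lorentz21_on_zero:
  assumes "\<And>t. t \<in> A \<Longrightarrow> f t = 0"
  shows "Lorentz21_on A f = 0"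
proof -
  have "ennsqrt (emeasure lebesgue {x\<in>A. norm (f x) \<ge> r}) * indicator {0<..} r = 0" for r
  proof (cases "0 < r")
    case True
    then have "{x\<in>A. norm (f x) \<ge> r} = {}" using assms by auto
    then show ?thesis by (simp only: emeasure_empty) (simp add: ennsqrt_def)
  qed simp
  then show ?thesis
    unfolding Lorentz21_on_def by (simp only: nn_integral_const) simp
qed

lemma nn_integral_inverse_affine:
  assumes "0 < c" "0 \<le> a" "a \<le> b" "0 \<le> K"
  shows "(\<integral>\<^sup>+t. ennreal (K / (1 + c * t)) * indicator {a..b} t \<partial>lborel)
    = ennreal (K * (ln (1 + c * b) - ln (1 + c * a)) / c)"
proof -
  have pos: "0 < 1 + c * t" if "a \<le> t" for t
    using assms that by (intro add_pos_nonneg mult_nonneg_nonneg) auto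
  have "(\<integral>\<^sup>+t. ennreal (K / (1 + c * t)) * indicator {a..b} t \<partial>lborel)
    = ennreal (K * ln (1 + c * b) / c - K * ln (1 + c * a) / c)"
  proof (rule nn_integral_FTC_Icc[where F = "\<lambda>t. K * ln (1 + c * t) / c"])
    fix t assume "t \<in> {a..b}"
    with pos have t: "0 < 1 + c * t" by auto
    show "((\<lambda>t. K * ln (1 + c * t) / c) has_real_derivative K / (1 + c * t)) (at t)"
      using t \<open>0 < c\<close> by (auto intro!: derivative_eq_intros)
    show "0 \<le> K / (1 + c * t)" using t assms by simp
  qed (use assms in auto)
  then show ?thesis by (simp add: right_diff_distrib diff_divide_distrib)
qed

lemma nn_integral_symmetric_le:
  fixes f :: "real \<Rightarrow> ennreal"
  assumes [measurable]: "f \<in> borel_measurable borel" and even: "\<And>t. f (- t) = f t"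
  shows "(\<integral>\<^sup>+t. f t * indicator {-b..b} t \<partial>lborel) \<le> 2 * (\<integral>\<^sup>+t. f t * indicator {0..b} t \<partial>lborel)"
proof -
  have refl: "(\<integral>\<^sup>+t. f t * indicator {-b..0} t \<partial>lborel) = (\<integral>\<^sup>+t. f t * indicator {0..b} t \<partial>lborel)"
    by (subst nn_integral_real_affine[where c = "-1" and t = 0])
      (auto simp: even indicator_def intro!: nn_integral_cong)
  have "(\<integral>\<^sup>+t. f t * indicator {-b..b} t \<partial>lborel)
      \<le> (\<integral>\<^sup>+t. f t * indicator {-b..0} t + f t * indicator {0..b} t \<partial>lborel)"
    by (intro nn_integral_mono) (auto simp: indicator_def)
  also have "\<dots> = (\<integral>\<^sup>+t. f t * indicator {-b..0} t \<partial>lborel) + (\<integral>\<^sup>+t. f t * indicator {0..b} t \<partial>lborel)"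
    by (rule nn_integral_add) auto
  finally show ?thesis by (simp add: refl mult_2)
qed

definition bubble_energy :: "nat \<Rightarrow> ennreal" where
  "bubble_energy n = (\<integral>\<^sup>+t. ennreal ((tent_potential (real n * t))\<^sup>2) * indicator {-1..1} t \<partial>lborel)"

lemma tent_potential_square_lower: "1 / (1 + \<bar>t\<bar>) \<le> (tent_potential t)\<^sup>2"
proof -
  have "(1 / sqrt (1 + \<bar>t\<bar>))\<^sup>2 \<le> (tent_potential t)\<^sup>2"
    using tent_potential_lower[of t] by (intro power_mono) auto
  then show ?thesis by (simp add: power_divide add_nonneg_nonneg)
qed

text \<open>
  Positivity and finiteness are needed for every \<open>n\<close>, also for \<open>n = 0\<close>, where the bubble is
  constant: they allow the exact normalisation of each \<open>U\<^sub>n\<close>.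
\<close>

lemma bubble_energy_pos: "0 < bubble_energy n"
proof -
  have "ennreal (1 / (1 + real n)) * indicator {-1..1} t \<le> ennreal ((tent_potential (real n * t))\<^sup>2) * indicator {-1..1} t" for t :: real
  proof (cases "t \<in> {-1..1}")
    case True
    then have "\<bar>real n * t\<bar> \<le> real n" by (auto simp: abs_mult intro!: mult_left_le)
    then have "1 / (1 + real n) \<le> 1 / (1 + \<bar>real n * t\<bar>)"
      by (intro divide_left_mono) (auto intro!: mult_pos_pos add_pos_nonneg)
    also have "\<dots> \<le> (tent_potential (real n * t))\<^sup>2" by (rule tent_potential_square_lower)
    finally show ?thesis using True by (simp add: ennreal_leI)
  qed simp
  then have "(\<integral>\<^sup>+t. ennreal (1 / (1 + real n)) * indicator {-1..1::real} t \<partial>lborel) \<le> bubble_energy n"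
    unfolding bubble_energy_def by (intro nn_integral_mono)
  moreover have "(\<integral>\<^sup>+t. ennreal (1 / (1 + real n)) * indicator {-1..1::real} t \<partial>lborel) = ennreal (1 / (1 + real n)) * 2"
    by (subst nn_integral_cmult_indicator) auto
  moreover have "0 < ennreal (1 / (1 + real n)) * 2"
    by (simp add: ennreal_zero_less_mult_iff)
  ultimately show ?thesis by (simp only: less_le_trans)
qed

lemma bubble_energy_upper:
  "\<exists>K>0. (\<forall>n. bubble_energy n < top) \<and>
     (\<forall>n>0. bubble_energy n \<le> ennreal (K * ln (1 + real n) / real n))"
proof -
  obtain K where K: "0 < K" "\<And>t. (tent_potential t)\<^sup>2 \<le> K / (1 + \<bar>t\<bar>)"
    using tent_potential_upper by blast
  have "bubble_energy n < top" for n
  proof -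
    have "(tent_potential t)\<^sup>2 \<le> K" for t
    proof -
      have "K / (1 + \<bar>t\<bar>) \<le> K / 1"
        using K(1) by (intro divide_left_mono) auto
      with K(2)[of t] show ?thesis by simp
    qed
    then have "bubble_energy n \<le> (\<integral>\<^sup>+t. ennreal K * indicator {-1..1::real} t \<partial>lborel)"
      unfolding bubble_energy_def by (intro nn_integral_mono mult_right_mono ennreal_leI) auto
    also have "\<dots> = ennreal K * 2"
      by (subst nn_integral_cmult_indicator) auto
    also have "\<dots> < top" by (simp add: ennreal_mult_less_top)
    finally show ?thesis .
  qed
  moreover have "bubble_energy n \<le> ennreal (2 * K * ln (1 + real n) / real n)" if "0 < n" for n
  proof -
    have "bubble_energy n \<le> (\<integral>\<^sup>+t. ennreal (K / (1 + real n * \<bar>t\<bar>)) * indicator {-1..1::real} t \<partial>lborel)"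
      unfolding bubble_energy_def using K(2)[of "real n * _"]
      by (intro nn_integral_mono mult_right_mono ennreal_leI) (auto simp: abs_mult)
    also have "\<dots> \<le> 2 * (\<integral>\<^sup>+t. ennreal (K / (1 + real n * \<bar>t\<bar>)) * indicator {0..1::real} t \<partial>lborel)"
      by (rule nn_integral_symmetric_le) auto
    also have "(\<integral>\<^sup>+t. ennreal (K / (1 + real n * \<bar>t\<bar>)) * indicator {0..1::real} t \<partial>lborel)
        = (\<integral>\<^sup>+t. ennreal (K / (1 + real n * t)) * indicator {0..1::real} t \<partial>lborel)"
      by (intro nn_integral_cong) (auto simp: indicator_def)
    also have "\<dots> = ennreal (K * ln (1 + real n) / real n)"
      using that K(1) by (subst nn_integral_inverse_affine) auto
    also have "2 * \<dots> = ennreal (2 * K * ln (1 + real n) / real n)"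
      using ennreal_mult'[of 2 "K * ln (1 + real n) / real n"] by (simp add: mult.assoc)
    finally show ?thesis .
  qed
  ultimately show ?thesis using K(1) by (intro exI[of _ "2 * K"]) simp
qed

section \<open>The concentrating sequence\<close>

theorem mainTheorem7:
  shows "\<exists>(U :: nat \<Rightarrow> real \<Rightarrow> real ^ 2)
          (\<Omega> :: nat \<Rightarrow> real \<Rightarrow> real ^ 2 ^ 2)
          (\<Omega>1 :: nat \<Rightarrow> real \<Rightarrow> real ^ 2 ^ 2).
     (\<forall>n. U n \<in> borel_measurable lebesgue \<and>
          \<Omega> n \<in> borel_measurable lebesgue \<and>
          \<Omega>1 n \<in> borel_measurable lebesgue) \<and>
     (\<forall>n t. \<Omega> n t \<in> so2) \<and>
     (\<forall>n t. quarter_laplacian_converges (U n) t \<and>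
            quarter_laplacian (U n) t = \<Omega> n t *v U n t + \<Omega>1 n t *v U n t) \<and>
     (\<lambda>n. L2_on {-1..1} (U n)) \<longlonglongrightarrow> 1 \<and>
     (\<exists>L :: real \<Rightarrow> ennreal.
        (\<forall>\<^sub>F R in at_top.
           (\<lambda>n. L2_on (neck R n) (\<Omega> n) + Lorentz21_on (neck R n) (\<Omega>1 n)) \<longlonglongrightarrow> L R) \<and>
        (L \<longlongrightarrow> 0) at_top) \<and>
     Liminf at_top (\<lambda>R::real. liminf (\<lambda>n. L2_on (neck R n) (U n))) > 0"
proof -
  obtain K where "0 < K" and energy_finite: "\<And>n. bubble_energy n < top"
    and energy_le: "\<And>n. 0 < n \<Longrightarrow> bubble_energy n \<le> ennreal (K * ln (1 + real n) / real n)"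
    using bubble_energy_upper by auto
  define m where "m n = enn2real (bubble_energy n)" for n
  have m: "bubble_energy n = ennreal (m n)" for n
    using energy_finite[of n] by (simp add: m_def)
  have m_pos: "0 < m n" for n
    using bubble_energy_pos[of n] by (simp add: m)
  have m_le: "m n \<le> K * ln (1 + real n) / real n" if "0 < n" for n
    using energy_le[OF that] \<open>0 < K\<close> that by (subst (asm) m, subst (asm) ennreal_le_iff) auto

  define e :: "real ^ 2" where "e = axis 1 1"
  have e: "norm e = 1" by (simp add: e_def)
  define v where "v n t = tent_potential (real n * t) / sqrt (m n)" for n t
  define D where "D n t = (\<integral>s. (v n t - v n s) / \<bar>t - s\<bar> powr (3/2) \<partial>lborel)" for n t
  define U where "U n t = v n t *\<^sub>R e" for n t
  define \<Omega>1 :: "nat \<Rightarrow> real \<Rightarrow> real ^ 2 ^ 2" where "\<Omega>1 n t = (D n t / v n t) *\<^sub>R mat 1" for n t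

  have v_meas [measurable]: "v n \<in> borel_measurable borel" for n
    unfolding v_def by measurable
  have D_meas [measurable]: "D n \<in> borel_measurable borel" for n
    unfolding D_def by measurable
  have v_pos: "0 < v n t" for n t
    using tent_potential_pos m_pos by (simp add: v_def)
  have int: "integrable lborel (\<lambda>s. (v n t - v n s) / \<bar>t - s\<bar> powr (3/2))" for n t
  proof -
    obtain C where C: "0 \<le> C" "\<And>t. tent_potential t \<le> C"
      "\<And>t s. \<bar>tent_potential t - tent_potential s\<bar> \<le> C * \<bar>t - s\<bar>"
      using tent_potential_bounded_lipschitz by auto
    \<comment> \<open>The factor \<open>1 + n\<close> bounds both the value (factor 1) and the dilated Lipschitz constant (factor \<open>n\<close>).\<close>
    let ?C = "C * (1 + real n) / sqrt (m n)"
    show ?thesis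
    proof (rule integrable_quarter_integrand[where C = ?C])
      have "tent_potential (real n * t) \<le> C * (1 + real n)" for t
        using C(2)[of "real n * t"] C(1) by (simp add: distrib_left add_increasing2)
      then show "\<bar>v n t\<bar> \<le> ?C" for t
        using tent_potential_pos[of "real n * t"] m_pos[of n]
        by (simp add: v_def divide_right_mono)
      have "\<bar>tent_potential (real n * t) - tent_potential (real n * s)\<bar> \<le> C * (1 + real n) * \<bar>t - s\<bar>" for t s
      proof -
        have "\<bar>tent_potential (real n * t) - tent_potential (real n * s)\<bar> \<le> C * \<bar>real n * t - real n * s\<bar>"
          by (rule C(3))
        also have "\<dots> = C * real n * \<bar>t - s\<bar>"
          by (simp add: abs_mult flip: right_diff_distrib)
        also have "\<dots> \<le> C * (1 + real n) * \<bar>t - s\<bar>"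
          using C(1) by (intro mult_right_mono mult_left_mono) auto
        finally show ?thesis .
      qed
      then show "\<bar>v n t - v n s\<bar> \<le> ?C * \<bar>t - s\<bar>" for t s
        using m_pos[of n] by (simp add: v_def divide_right_mono flip: diff_divide_distrib)
    qed measurable
  qed
  have D_eq_0: "D n t = 0" if "1 < \<bar>real n * t\<bar>" for n t
  proof -
    have "(v n t - v n s) / \<bar>t - s\<bar> powr (3/2)
      = (tent_potential (real n * t) - tent_potential (real n * s)) / \<bar>t - s\<bar> powr (3/2) / sqrt (m n)" for s
      by (simp add: v_def diff_divide_distrib mult.commute)
    then show ?thesis
      unfolding D_def
      by (simp only: integral_divide_zero quarter_integral_tent_potential_rescaled_eq_0[OF that] div_0)
  qed
  have neck_far: "1 < \<bar>real n * t\<bar>" if "t \<in> neck R n" "1 < R" "0 < n" for n t and R :: real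
  proof -
    have "R / real n \<le> \<bar>t\<bar>" using that(1) by (simp add: neck_def)
    then have "R \<le> real n * \<bar>t\<bar>" using that(3) by (simp add: divide_le_eq mult.commute)
    then show ?thesis using that(2) by (simp add: abs_mult)
  qed

  have lim0: "(\<lambda>n. L2_on (neck R n) (\<lambda>_. 0 :: real ^ 2 ^ 2) + Lorentz21_on (neck R n) (\<Omega>1 n)) \<longlonglongrightarrow> 0"
    if "1 < R" for R
  proof (rule tendsto_eventually, rule eventually_mono[OF eventually_gt_at_top[of 0]])
    fix n :: nat assume "0 < n"
    have "Lorentz21_on (neck R n) (\<Omega>1 n) = 0"
      by (rule Lorentz21_on_zero) (simp add: \<Omega>1_def D_eq_0[OF neck_far[OF _ \<open>1 < R\<close> \<open>0 < n\<close>]])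
    then show "L2_on (neck R n) (\<lambda>_. 0 :: real ^ 2 ^ 2) + Lorentz21_on (neck R n) (\<Omega>1 n) = 0"
      by (simp add: L2_on_zero)
  qed

  have L2_U: "L2_on A (U n) = ennsqrt (ennreal (1 / m n) *
      (\<integral>\<^sup>+t. ennreal ((tent_potential (real n * t))\<^sup>2) * indicator A t \<partial>lborel))"
    if [measurable]: "A \<in> sets borel" for A n
  proof -
    have "ennreal ((v n t)\<^sup>2) * indicator A t
        = ennreal (1 / m n) * (ennreal ((tent_potential (real n * t))\<^sup>2) * indicator A t)" for t
      using m_pos[of n] by (simp add: v_def power_divide ennreal_mult'[symmetric] mult.assoc[symmetric])
    then show ?thesis
      unfolding U_def L2_on_scaleR[OF e] by (simp add: nn_integral_cmult)
  qed
  have norm1: "L2_on {-1..1} (U n) = 1" for n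
    using m_pos[of n] by (simp add: L2_U m ennsqrt_def ennreal_mult'[symmetric] flip: bubble_energy_def)

  \<comment> \<open>The ratio of the lower energy bound on the neck to the upper one on \<open>[-1, 1]\<close> tends to
    \<open>1 / K\<close>, for every fixed \<open>R\<close>; half of that limit is reached for large \<open>n\<close>.\<close>
  let ?c = "ennreal (sqrt (1 / (2 * K)))"
  have neck_lower: "eventually (\<lambda>n. ?c \<le> L2_on (neck R n) (U n)) sequentially" if "1 < R" for R
  proof -
    have "eventually (\<lambda>n. ln (1 + real n) / 2 \<le> ln (1 + real n / (2 * R)) - ln (1 + R)) sequentially"
      using that by real_asymp
    moreover have "eventually (\<lambda>n. 2 * R * R \<le> real n) sequentially"
      by real_asymp
    moreover have "eventually (\<lambda>n::nat. 0 < n) sequentially"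
      by (rule eventually_gt_at_top)
    ultimately show ?thesis
    proof eventually_elim
      case (elim n)
      have R: "0 < R" using that by simp
      have neck [measurable]: "neck R n \<in> sets borel"
        by (simp add: neck_def)
      \<comment> \<open>A closed interval inside the open-ended right half of the neck already carries enough energy.\<close>
      have sub: "{R / real n..1 / (2 * R)} \<subseteq> neck R n"
      proof
        fix t assume "t \<in> {R / real n..1 / (2 * R)}"
        moreover from this have "0 < t" using R elim(3) by (auto intro: less_le_trans[of 0 "R / real n"])
        moreover have "1 / (2 * R) < 1 / R" using R by (simp add: divide_simps)
        ultimately show "t \<in> neck R n" by (auto simp: neck_def)
      qed
      have "1 / (2 * K) \<le> 1 / m n * (1 * (ln (1 + real n * (1 / (2 * R))) - ln (1 + real n * (R / real n))) / real n)"
      proof -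
        have ln: "0 < ln (1 + real n)" using elim(3) by simp
        have "1 / (2 * K) = 1 / (K * ln (1 + real n) / real n) * (ln (1 + real n) / 2 / real n)"
          using ln \<open>0 < K\<close> elim(3) by simp
        also have "\<dots> \<le> 1 / m n * ((ln (1 + real n / (2 * R)) - ln (1 + R)) / real n)"
          using elim m_le[OF elim(3)] m_pos[of n] \<open>0 < K\<close> ln
          by (intro mult_mono divide_left_mono divide_right_mono mult_pos_pos divide_pos_pos) auto
        finally show ?thesis using elim(3) by simp
      qed
      then have "ennreal (1 / (2 * K)) \<le> ennreal (1 / m n)
          * ennreal (1 * (ln (1 + real n * (1 / (2 * R))) - ln (1 + real n * (R / real n))) / real n)"
        using m_pos[of n] by (simp add: ennreal_leI ennreal_mult'[symmetric])
      also have "\<dots> = ennreal (1 / m n) *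
          (\<integral>\<^sup>+t. ennreal (1 / (1 + real n * t)) * indicator {R / real n..1 / (2 * R)} t \<partial>lborel)"
        using R elim by (subst nn_integral_inverse_affine) (auto simp: divide_simps mult_ac)
      also have "\<dots> \<le> ennreal (1 / m n) *
          (\<integral>\<^sup>+t. ennreal ((tent_potential (real n * t))\<^sup>2) * indicator (neck R n) t \<partial>lborel)"
      proof (intro mult_left_mono nn_integral_mono)
        fix t
        show "ennreal (1 / (1 + real n * t)) * indicator {R / real n..1 / (2 * R)} t
          \<le> ennreal ((tent_potential (real n * t))\<^sup>2) * indicator (neck R n) t"
        proof (cases "t \<in> {R / real n..1 / (2 * R)}")
          case True
          then have "0 \<le> t" using R by (auto intro: order_trans[of 0 "R / real n"])
          then have "1 / (1 + real n * t) \<le> (tent_potential (real n * t))\<^sup>2"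
            using tent_potential_square_lower[of "real n * t"] by simp
          with True sub show ?thesis by (auto simp: ennreal_leI)
        qed simp
      qed simp
      finally have "ennsqrt (ennreal (1 / (2 * K))) \<le> L2_on (neck R n) (U n)"
        unfolding L2_U[OF neck] by (rule ennsqrt_mono)
      then show ?case using \<open>0 < K\<close> by (subst (asm) ennsqrt_ennreal) auto
    qed
  qed
  have "?c \<le> Liminf at_top (\<lambda>R::real. liminf (\<lambda>n. L2_on (neck R n) (U n)))"
  proof (intro Liminf_bounded)
    show "\<forall>\<^sub>F R in at_top. ?c \<le> liminf (\<lambda>n. L2_on (neck R n) (U n))"
      using eventually_gt_at_top[of "1::real"]
      by eventually_elim (intro Liminf_bounded neck_lower)
  qed
  moreover have "0 < ?c" using \<open>0 < K\<close> by simp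
  ultimately have liminf: "0 < Liminf at_top (\<lambda>R::real. liminf (\<lambda>n. L2_on (neck R n) (U n)))"
    by (rule less_le_trans[rotated])

  show ?thesis
  proof (intro exI conjI allI)
    fix n t
    show "U n \<in> borel_measurable lebesgue"
      unfolding U_def by (intro borel_measurable_scaleR measurable_completion) measurable
    show "(\<lambda>_. 0 :: real ^ 2 ^ 2) \<in> borel_measurable lebesgue" by simp
    show "\<Omega>1 n \<in> borel_measurable lebesgue"
      unfolding \<Omega>1_def by (intro borel_measurable_scaleR measurable_completion) measurable
    show "0 \<in> so2" by (simp add: so2_def transpose_def vec_eq_iff)
    show "quarter_laplacian_converges (U n) t"
      unfolding U_def using int by (intro quarter_laplacian_scaleR) auto
    have "quarter_laplacian (U n) t = D n t *\<^sub>R e"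
      unfolding U_def D_def using int by (intro quarter_laplacian_scaleR) auto
    also have "\<dots> = \<Omega>1 n t *v U n t"
      using v_pos[of n t] by (simp add: \<Omega>1_def U_def scaleR_matrix_vector_assoc[symmetric])
    finally show "quarter_laplacian (U n) t = 0 *v U n t + \<Omega>1 n t *v U n t" by simp
    show "(\<lambda>n. L2_on {-1..1} (U n)) \<longlonglongrightarrow> 1" by (simp add: norm1)
    show "((\<lambda>_. 0) \<longlongrightarrow> 0) at_top" by simp
    show "\<forall>\<^sub>F R in at_top. (\<lambda>n. L2_on (neck R n) (\<lambda>_. 0 :: real ^ 2 ^ 2) + Lorentz21_on (neck R n) (\<Omega>1 n)) \<longlonglongrightarrow> 0"
      using eventually_gt_at_top[of "1::real"] by eventually_elim (rule lim0)
    show "0 < Liminf at_top (\<lambda>R::real. liminf (\<lambda>n. L2_on (neck R n) (U n)))" by (rule liminf)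
  qed
qed

end
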